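(* Let $k$ be a field, let $R=k[x_1,\ldots,x_n]$, let $X\subseteq k^n$, and let $\nu:X\to\mathbb{N}_{>0}$ be bounded. Then, for every ideal $I$ of $R$, $$\sqrt{\Phi^{*}_{X,\nu}(I)}=\mathcal{I}\bigl(V_X(I)\bigr).$$
   Context: For $a=(a_1,\ldots,a_n)\in k^n$, $\mathfrak{m}_a=(x_1-a_1,\ldots,x_n-a_n)\subseteq R$. For an ideal $I$ of $R$, $V_{\mathrm{aff}}(I)=\{a\in k^n: f(a)=0\text{ for every }f\in I\}$ and $V_X(I)=X\cap V_{\mathrm{aff}}(I)$. For $Y\subseteq k^n$, $\mathcal{I}(Y)=\{f\in R: f(a)=0\text{ for every }a\in Y\}$; in particular $\mathcal{I}(\varnothing)=R$. For every subset $A\subseteq R$, $$\Phi^{*}_{X,\nu}(A)=\bigcap_{a\in X}\bigl(A+\mathfrak{m}_a^{\nu(a)}\bigr),$$ where $A+B=\{a+b:a\in A,b\in B\}$ and the intersection is $R$ if $X=\varnothing$. The function $\nu$ is bounded if there is a positive integer $N$ with $\nu(a)\le N$ for every $a\in X$. The radical of the unit ideal $R$ is $R$. *)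

theory Defs
  imports "HOL-Algebra.Ideal_Product" "HOL-Library.Poly_Mapping"
begin

text \<open>
  A monomial is a finitely supported exponent map \<open>nat \<Rightarrow>\<^sub>0 nat\<close>; a polynomial is a finitely
  supported map from monomials to coefficients, and multiplication of such maps is convolution.
  The variables $x_1, \ldots, x_n$ are numbered \<open>0, \<dots>, n - 1\<close>, so $k[x_1,\ldots,x_n]$ consists of
  the polynomials in whose monomials only indices below \<open>n\<close> occur.
\<close>

type_synonym 'k mpoly = "(nat \<Rightarrow>\<^sub>0 nat) \<Rightarrow>\<^sub>0 'k"

definition mpoly_ring :: "nat \<Rightarrow> 'k::field mpoly ring" where
  "mpoly_ring n =
     \<lparr> carrier = {p. \<forall>m \<in> Poly_Mapping.keys p. Poly_Mapping.keys m \<subseteq> {..<n}},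
       mult = (*), one = 1, zero = 0, add = (+) \<rparr>"

definition mpoly_const :: "'k::field \<Rightarrow> 'k mpoly" where
  "mpoly_const c = Poly_Mapping.single 0 c"

definition mpoly_var :: "nat \<Rightarrow> 'k::field mpoly" where
  "mpoly_var i = Poly_Mapping.single (Poly_Mapping.single i 1) 1"

definition mpoly_eval :: "'k::field mpoly \<Rightarrow> (nat \<Rightarrow> 'k) \<Rightarrow> 'k" where
  "mpoly_eval p a =
     (\<Sum>m \<in> Poly_Mapping.keys p. Poly_Mapping.lookup p m *
        (\<Prod>i \<in> Poly_Mapping.keys m. a i ^ Poly_Mapping.lookup m i))"

text \<open>
  Points of $k^n$ are functions fixed to \<open>undefined\<close> outside \<open>{..<n}\<close>, so that distinct functions
  are distinct points (and $k^0$ is a single point).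
\<close>

definition affine_points :: "nat \<Rightarrow> (nat \<Rightarrow> 'k::field) set" where
  "affine_points n = {..<n} \<rightarrow>\<^sub>E UNIV"

definition point_ideal :: "nat \<Rightarrow> (nat \<Rightarrow> 'k::field) \<Rightarrow> 'k mpoly set" where
  "point_ideal n a = Idl\<^bsub>mpoly_ring n\<^esub> ((\<lambda>i. mpoly_var i - mpoly_const (a i)) ` {..<n})"

definition V_aff :: "nat \<Rightarrow> 'k::field mpoly set \<Rightarrow> (nat \<Rightarrow> 'k) set" where
  "V_aff n I = {a \<in> affine_points n. \<forall>f \<in> I. mpoly_eval f a = 0}"

definition V_on :: "nat \<Rightarrow> (nat \<Rightarrow> 'k::field) set \<Rightarrow> 'k mpoly set \<Rightarrow> (nat \<Rightarrow> 'k) set" where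
  "V_on n X I = X \<inter> V_aff n I"

definition vanishing_ideal :: "nat \<Rightarrow> (nat \<Rightarrow> 'k::field) set \<Rightarrow> 'k mpoly set" where
  "vanishing_ideal n Y = {f \<in> carrier (mpoly_ring n). \<forall>a \<in> Y. mpoly_eval f a = 0}"

text \<open>
  The power of \<open>point_ideal n a\<close> is taken in \<^const>\<open>ideals_set\<close>, whose multiplication is the product
  of ideals (sums of products of elements) and whose unit is the whole ring.  Intersecting
  with the carrier matters only for \<open>X = {}\<close>, where the result is the whole ring.
\<close>

definition Phi_star ::
    "nat \<Rightarrow> (nat \<Rightarrow> 'k::field) set \<Rightarrow> ((nat \<Rightarrow> 'k) \<Rightarrow> nat) \<Rightarrow> 'k mpoly set \<Rightarrow> 'k mpoly set" where
  "Phi_star n X \<nu> A = carrier (mpoly_ring n) \<inter>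
     (\<Inter>a \<in> X. A <+>\<^bsub>mpoly_ring n\<^esub> (point_ideal n a [^]\<^bsub>ideals_set (mpoly_ring n)\<^esub> \<nu> a))"

definition radical :: "('a, 'b) ring_scheme \<Rightarrow> 'a set \<Rightarrow> 'a set" where
  "radical R J = {f \<in> carrier R. \<exists>m::nat. 0 < m \<and> f [^]\<^bsub>R\<^esub> m \<in> J}"

definition bounded_orders :: "'p set \<Rightarrow> ('p \<Rightarrow> nat) \<Rightarrow> bool" where
  "bounded_orders X \<nu> \<longleftrightarrow> (\<exists>N>0. \<forall>a \<in> X. \<nu> a \<le> N)"

lemma cring_mpoly_ring: "cring (mpoly_ring n :: 'k::field mpoly ring)"
proof (rule cringI)
  have uminus: "\<exists>q. (\<forall>m \<in> Poly_Mapping.keys q. Poly_Mapping.keys m \<subseteq> {..<n}) \<and> q + p = 0"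
    if "\<forall>m \<in> Poly_Mapping.keys p. Poly_Mapping.keys m \<subseteq> {..<n}" for p :: "'k mpoly"
    by (rule exI[of _ "- p"]) (use that in \<open>auto simp: in_keys_iff\<close>)
  show "abelian_group (mpoly_ring n :: 'k mpoly ring)"
  proof (rule abelian_groupI)
    fix x y :: "'k mpoly"
    assume "x \<in> carrier (mpoly_ring n)" "y \<in> carrier (mpoly_ring n)"
    then show "x \<oplus>\<^bsub>mpoly_ring n\<^esub> y \<in> carrier (mpoly_ring n)"
      using Poly_Mapping.keys_add[of x y] by (fastforce simp: mpoly_ring_def)
  qed (use uminus in \<open>auto simp: mpoly_ring_def algebra_simps\<close>)
  show "Group.comm_monoid (mpoly_ring n :: 'k mpoly ring)"
  proof (rule comm_monoidI)
    fix x y :: "'k mpoly"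
    assume *: "x \<in> carrier (mpoly_ring n)" "y \<in> carrier (mpoly_ring n)"
    have "Poly_Mapping.keys m \<subseteq> {..<n}" if m: "m \<in> Poly_Mapping.keys (x * y)" for m
    proof -
      obtain u v where "m = u + v" "u \<in> Poly_Mapping.keys x" "v \<in> Poly_Mapping.keys y"
        using m Poly_Mapping.keys_mult[of x y] by auto
      then show ?thesis
        using * Poly_Mapping.keys_add[of u v] by (fastforce simp: mpoly_ring_def)
    qed
    then show "x \<otimes>\<^bsub>mpoly_ring n\<^esub> y \<in> carrier (mpoly_ring n)"
      by (simp add: mpoly_ring_def)
  qed (auto simp: mpoly_ring_def algebra_simps)
qed (auto simp: mpoly_ring_def algebra_simps)

end

theory Submission
  imports Defs
begin

text \<open>
  Evaluation at a point \<open>a\<close> is a ring homomorphism \<open>R \<rightarrow> k\<close> whose kernel is \<open>\<mm>\<^sub>a\<close>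
  (\<open>point_ideal_eq_kernel\<close>), and everything is decided one point of \<open>X\<close> at a time.

  If \<open>f\<^sup>m\<close> lies in \<open>I + \<mm>\<^sub>a\<^bsup>\<nu>(a)\<^esup>\<close> and \<open>a\<close> is a zero of \<open>I\<close>, then both summands consist of
  polynomials vanishing at \<open>a\<close>, because \<open>\<nu>(a) > 0\<close>. Hence \<open>f(a)\<^sup>m = 0\<close>, so \<open>f(a) = 0\<close>.

  Conversely let \<open>f\<close> vanish on \<open>V\<^sub>X(I)\<close> and let \<open>N\<close> bound \<open>\<nu>\<close>; the single exponent \<open>N\<close> works at
  every point. If \<open>a \<in> X\<close> is a zero of \<open>I\<close>, then \<open>f \<in> \<mm>\<^sub>a\<close>, so
  \<open>f\<^sup>N \<in> \<mm>\<^sub>a\<^sup>N \<subseteq> \<mm>\<^sub>a\<^bsup>\<nu>(a)\<^esup>\<close> (\<open>pow_mem_ideal_power\<close>). If it is not, some \<open>g \<in> I\<close> has \<open>g(a) = 1\<close>,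
  so \<open>1 = g + (1 - g)\<close> shows that \<open>I\<close> and \<open>\<mm>\<^sub>a\<close> are comaximal; then \<open>I\<close> is comaximal with every
  power of \<open>\<mm>\<^sub>a\<close> (\<open>comaximal_ideal_power\<close>), and \<open>I + \<mm>\<^sub>a\<^bsup>\<nu>(a)\<^esup> = R\<close> contains \<open>f\<^sup>N\<close>.
\<close>

section \<open>Powers of ideals in a commutative ring\<close>

context cring
begin

lemma ideal_power_is_ideal:
  assumes "ideal J R"
  shows "ideal (J [^]\<^bsub>ideals_set R\<^esub> (k::nat)) R"
proof (induction k)
  case 0
  show ?case by (simp add: ideals_set_def oneideal)
next
  case (Suc k)
  then show ?case
    using ideal_prod_is_ideal[OF _ assms] by (simp add: ideals_set_def)
qed

lemma ideal_power_subset: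
  assumes "ideal J R" "0 < (k::nat)"
  shows "J [^]\<^bsub>ideals_set R\<^esub> k \<subseteq> J"
proof -
  obtain l where "k = Suc l"
    using assms(2) gr0_conv_Suc by blast
  then show ?thesis
    using ideal_prod_inter[OF ideal_power_is_ideal[OF assms(1), of l] assms(1)]
    by (simp add: ideals_set_def)
qed

lemma pow_mem_ideal_power:
  assumes J: "ideal J R" and x: "x \<in> J" and "k \<le> (l::nat)"
  shows "x [^] l \<in> J [^]\<^bsub>ideals_set R\<^esub> k"
  using \<open>k \<le> l\<close>
proof (induction l rule: dec_induct)
  case base
  have x_carrier: "x \<in> carrier R"
    using J x by (rule ideal.Icarr)
  show ?case
    by (induction k) (use x x_carrier in \<open>auto simp: ideals_set_def intro: ideal_prod.prod\<close>)
next
  case (step l)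
  then show ?case
    using ideal.I_r_closed[OF ideal_power_is_ideal[OF J]] ideal.Icarr[OF J x] by simp
qed

text \<open>
  If \<open>1 = g + h\<close> with \<open>g \<in> I\<close>, \<open>h \<in> J\<close> and \<open>1 = g' + h'\<close> with \<open>g' \<in> I\<close>, \<open>h' \<in> J\<^sup>k\<close>, then
  expanding \<open>1 = g' + h' (g + h)\<close> moves the decomposition to \<open>J\<^bsup>k+1\<^esup>\<close>.
\<close>

lemma comaximal_ideal_power:
  assumes I: "ideal I R" and J: "ideal J R" and "\<one> \<in> I <+> J"
  shows "I <+> (J [^]\<^bsub>ideals_set R\<^esub> (k::nat)) = carrier R"
proof -
  from assms(3) obtain g h where gh: "g \<in> I" "h \<in> J" "\<one> = g \<oplus> h"
    by (auto simp: set_add_def')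
  note carr = ideal.Icarr[OF I] ideal.Icarr[OF J]
  have "\<one> \<in> I <+> (J [^]\<^bsub>ideals_set R\<^esub> k)"
  proof (induction k)
    case 0
    have "\<zero> \<in> I"
      using additive_subgroup.zero_closed[OF ideal.axioms(1)[OF I]] .
    then have "\<zero> \<oplus> \<one> \<in> I <+> carrier R"
      unfolding set_add_def' using one_closed by blast
    then show ?case
      by (simp add: ideals_set_def)
  next
    case (Suc k)
    then obtain g' h' where gh': "g' \<in> I" "h' \<in> J [^]\<^bsub>ideals_set R\<^esub> k" "\<one> = g' \<oplus> h'"
      by (auto simp: set_add_def')
    have h'_carrier: "h' \<in> carrier R"
      using ideal.Icarr[OF ideal_power_is_ideal[OF J] gh'(2)] .
    have "h' \<otimes> (g \<oplus> h) = h'"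
      unfolding gh(3)[symmetric] by (rule r_one[OF h'_carrier])
    then have "\<one> = g' \<oplus> h' \<otimes> (g \<oplus> h)"
      using gh'(3) by (simp only:)
    also have "\<dots> = (g' \<oplus> h' \<otimes> g) \<oplus> h' \<otimes> h"
      using carr gh gh' h'_carrier by (simp add: r_distr a_assoc)
    finally have "\<one> = (g' \<oplus> h' \<otimes> g) \<oplus> h' \<otimes> h" .
    moreover have "g' \<oplus> h' \<otimes> g \<in> I"
      using gh'(1) ideal.I_l_closed[OF I gh(1) h'_carrier]
        additive_subgroup.a_closed[OF ideal.axioms(1)[OF I]] by blast
    moreover have "h' \<otimes> h \<in> J [^]\<^bsub>ideals_set R\<^esub> Suc k"
      using gh'(2) gh(2) by (auto simp: ideals_set_def intro: ideal_prod.prod)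
    ultimately show ?case
      unfolding set_add_def' by blast
  qed
  then show ?thesis
    using ideal.one_imp_carrier add_ideals[OF I ideal_power_is_ideal[OF J]] by blast
qed

end

section \<open>Evaluation of polynomials\<close>

lemma mpoly_ring_simps [simp]:
  "x \<otimes>\<^bsub>mpoly_ring n\<^esub> y = x * y" "x \<oplus>\<^bsub>mpoly_ring n\<^esub> y = x + y"
  "\<one>\<^bsub>mpoly_ring n\<^esub> = 1" "\<zero>\<^bsub>mpoly_ring n\<^esub> = 0"
  by (simp_all add: mpoly_ring_def)

lemma mpoly_ring_pow [simp]: "x [^]\<^bsub>mpoly_ring n\<^esub> (k::nat) = x ^ k"
  by (induction k) (simp_all add: power_Suc2 del: power_Suc)

lemma poly_mapping_sum_singles:
  fixes p :: "'a \<Rightarrow>\<^sub>0 'b::comm_monoid_add"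
  shows "p = (\<Sum>m\<in>Poly_Mapping.keys p. Poly_Mapping.single m (Poly_Mapping.lookup p m))"
proof (rule poly_mapping_eqI)
  fix k
  show "Poly_Mapping.lookup p k =
    Poly_Mapping.lookup
      (\<Sum>m\<in>Poly_Mapping.keys p. Poly_Mapping.single m (Poly_Mapping.lookup p m)) k"
    by (simp add: lookup_sum lookup_single when_def sum.delta in_keys_iff)
qed

definition monomial_eval :: "(nat \<Rightarrow>\<^sub>0 nat) \<Rightarrow> (nat \<Rightarrow> 'k::field) \<Rightarrow> 'k" where
  "monomial_eval m a = (\<Prod>i\<in>Poly_Mapping.keys m. a i ^ Poly_Mapping.lookup m i)"

lemma monomial_eval_add: "monomial_eval (m + m') a = monomial_eval m a * monomial_eval m' a"
proof -
  let ?S = "Poly_Mapping.keys m \<union> Poly_Mapping.keys m'"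
  have extend: "monomial_eval u a = (\<Prod>i\<in>?S. a i ^ Poly_Mapping.lookup u i)"
    if "Poly_Mapping.keys u \<subseteq> ?S" for u
    unfolding monomial_eval_def
    by (rule prod.mono_neutral_left) (use that in \<open>auto simp: in_keys_iff\<close>)
  show ?thesis
    using Poly_Mapping.keys_add[of m m']
    by (simp add: extend lookup_add power_add prod.distrib)
qed

lemma mpoly_eval_single: "mpoly_eval (Poly_Mapping.single m c) a = c * monomial_eval m a"
  by (simp add: mpoly_eval_def monomial_eval_def)

lemma mpoly_eval_0 [simp]: "mpoly_eval 0 a = 0"
  by (simp add: mpoly_eval_def)

lemma mpoly_eval_const [simp]: "mpoly_eval (mpoly_const c) a = c"
  by (simp add: mpoly_const_def mpoly_eval_single monomial_eval_def)

lemma mpoly_eval_var [simp]: "mpoly_eval (mpoly_var i) a = a i"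
  by (simp add: mpoly_var_def mpoly_eval_single monomial_eval_def)

lemma mpoly_eval_1 [simp]: "mpoly_eval 1 a = 1"
  using mpoly_eval_const[of 1 a] by (simp add: mpoly_const_def)

lemma mpoly_eval_add [simp]: "mpoly_eval (p + q) a = mpoly_eval p a + mpoly_eval q a"
  unfolding mpoly_eval_def
  by (rule setsum_keys_plus_distrib) (simp_all add: algebra_simps)

lemma mpoly_eval_diff [simp]: "mpoly_eval (p - q) a = mpoly_eval p a - mpoly_eval q a"
  using mpoly_eval_add[of "p - q" q a] by (simp add: algebra_simps)

lemma mpoly_eval_sum: "mpoly_eval (sum F A) a = (\<Sum>x\<in>A. mpoly_eval (F x) a)"
  by (induction A rule: infinite_finite_induct) simp_all

lemma mpoly_eval_mult [simp]: "mpoly_eval (p * q) a = mpoly_eval p a * mpoly_eval q a"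
proof -
  let ?t = "\<lambda>p m. Poly_Mapping.single m (Poly_Mapping.lookup p m) :: 'a mpoly"
  have "mpoly_eval (p * q) a =
      mpoly_eval (sum (?t p) (Poly_Mapping.keys p) * sum (?t q) (Poly_Mapping.keys q)) a"
    by (simp flip: poly_mapping_sum_singles)
  also have "\<dots> = (\<Sum>m\<in>Poly_Mapping.keys p. \<Sum>m'\<in>Poly_Mapping.keys q.
      mpoly_eval (?t p m) a * mpoly_eval (?t q m') a)"
    by (simp add: sum_product mpoly_eval_sum mult_single mpoly_eval_single monomial_eval_add
        mult.assoc mult.left_commute)
  also have "\<dots> = mpoly_eval (sum (?t p) (Poly_Mapping.keys p)) a
      * mpoly_eval (sum (?t q) (Poly_Mapping.keys q)) a"
    by (simp add: sum_product mpoly_eval_sum)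
  finally show ?thesis
    by (simp flip: poly_mapping_sum_singles)
qed

lemma mpoly_eval_pow [simp]: "mpoly_eval (p ^ k) a = mpoly_eval p a ^ k"
  by (induction k) simp_all

section \<open>The ideal of a point as a kernel\<close>

lemma mpoly_const_carrier [simp]: "mpoly_const c \<in> carrier (mpoly_ring n)"
  by (simp add: mpoly_ring_def mpoly_const_def)

lemma mpoly_var_carrier: "i < n \<Longrightarrow> mpoly_var i \<in> carrier (mpoly_ring n)"
  by (simp add: mpoly_ring_def mpoly_var_def)

lemma mpoly_add_carrier:
  "p \<in> carrier (mpoly_ring n) \<Longrightarrow> q \<in> carrier (mpoly_ring n) \<Longrightarrow> p + q \<in> carrier (mpoly_ring n)"
  using ring.ring_simprules(1)[OF cring.axioms(1)[OF cring_mpoly_ring], of p n q] by simp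

lemma mpoly_mult_carrier:
  "p \<in> carrier (mpoly_ring n) \<Longrightarrow> q \<in> carrier (mpoly_ring n) \<Longrightarrow> p * q \<in> carrier (mpoly_ring n)"
  using ring.ring_simprules(5)[OF cring.axioms(1)[OF cring_mpoly_ring], of p n q] by simp

lemma mpoly_diff_carrier:
  "p \<in> carrier (mpoly_ring n) \<Longrightarrow> q \<in> carrier (mpoly_ring n) \<Longrightarrow> p - q \<in> carrier (mpoly_ring n)"
  using Poly_Mapping.keys_diff[of p q] by (auto simp: mpoly_ring_def)

text \<open>
  The constants and the variables generate \<open>k[x\<^sub>1, \<dots>, x\<^sub>n]\<close>: a monomial is built up one variable at
  a time, by induction on its total degree.
\<close>

lemma mpoly_carrier_induct [consumes 1, case_names const var add mult]:
  assumes "f \<in> carrier (mpoly_ring n)"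
    and const: "\<And>c. P (mpoly_const c)"
    and var: "\<And>i. i < n \<Longrightarrow> P (mpoly_var i)"
    and closed_add: "\<And>p q. p \<in> carrier (mpoly_ring n) \<Longrightarrow> q \<in> carrier (mpoly_ring n)
      \<Longrightarrow> P p \<Longrightarrow> P q \<Longrightarrow> P (p + q)"
    and closed_mult: "\<And>p q. p \<in> carrier (mpoly_ring n) \<Longrightarrow> q \<in> carrier (mpoly_ring n)
      \<Longrightarrow> P p \<Longrightarrow> P q \<Longrightarrow> P (p * q)"
  shows "P f"
proof -
  have single_carrier: "Poly_Mapping.single m c \<in> carrier (mpoly_ring n)"
    if "Poly_Mapping.keys m \<subseteq> {..<n}" for m and c :: 'a
    using that by (simp add: mpoly_ring_def)
  have P_single: "P (Poly_Mapping.single m c)" if "Poly_Mapping.keys m \<subseteq> {..<n}" for m c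
    using that
  proof (induction "\<Sum>i<n. Poly_Mapping.lookup m i" arbitrary: m)
    case 0
    then have "m = 0"
      by (fastforce simp: in_keys_iff intro!: poly_mapping_eqI)
    then show ?case
      using const by (simp add: mpoly_const_def)
  next
    case (Suc d)
    have "\<exists>i<n. Poly_Mapping.lookup m i \<noteq> 0"
    proof (rule ccontr)
      assume "\<not> ?thesis"
      then have "(\<Sum>i<n. Poly_Mapping.lookup m i) = 0"
        by simp
      then show False
        using Suc.hyps(2) by simp
    qed
    then obtain i where i: "i < n" "Poly_Mapping.lookup m i \<noteq> 0"
      by blast
    define m' where "m' = m - Poly_Mapping.single i 1"
    have m: "m = Poly_Mapping.single i 1 + m'"
      using i(2) by (auto simp: m'_def lookup_add lookup_minus lookup_single when_def
          intro!: poly_mapping_eqI)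
    have keys_m': "Poly_Mapping.keys m' \<subseteq> {..<n}"
    proof
      fix j
      assume "j \<in> Poly_Mapping.keys m'"
      then have "j \<in> Poly_Mapping.keys m"
        by (simp add: m'_def in_keys_iff lookup_minus)
      then show "j \<in> {..<n}"
        using Suc.prems by blast
    qed
    have "(\<Sum>i<n. Poly_Mapping.lookup m i) = 1 + (\<Sum>i<n. Poly_Mapping.lookup m' i)"
      by (subst m) (use i(1) in \<open>simp add: lookup_add sum.distrib lookup_single when_def\<close>)
    then have "d = (\<Sum>i<n. Poly_Mapping.lookup m' i)"
      using Suc.hyps(2) by linarith
    then have "P (Poly_Mapping.single m' c)"
      using Suc.hyps(1) keys_m' by blast
    then have "P (mpoly_var i * Poly_Mapping.single m' c)"
      by (intro closed_mult var mpoly_var_carrier single_carrier i(1) keys_m')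
    then show ?case
      by (subst m) (simp add: mpoly_var_def mult_single)
  qed
  have keys_f: "\<And>m. m \<in> Poly_Mapping.keys f \<Longrightarrow> Poly_Mapping.keys m \<subseteq> {..<n}"
    using assms(1) by (auto simp: mpoly_ring_def)
  \<comment> \<open>Membership of the partial sums is carried along because \<open>closed_add\<close> asks for it.\<close>
  have "finite A \<Longrightarrow> A \<subseteq> Poly_Mapping.keys f \<Longrightarrow>
    (\<Sum>m\<in>A. Poly_Mapping.single m (Poly_Mapping.lookup f m)) \<in> carrier (mpoly_ring n) \<and>
    P (\<Sum>m\<in>A. Poly_Mapping.single m (Poly_Mapping.lookup f m))" for A
  proof (induction A rule: finite_induct)
    case empty
    show ?case
      using const[of 0] mpoly_const_carrier[of 0 n] by (simp add: mpoly_const_def)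
  next
    case (insert m A)
    then show ?case
      by (simp add: closed_add P_single single_carrier keys_f mpoly_add_carrier)
  qed
  from this[of "Poly_Mapping.keys f"] show ?thesis
    by (simp flip: poly_mapping_sum_singles)
qed

lemma point_ideal_is_ideal: "ideal (point_ideal n a) (mpoly_ring n)"
proof -
  interpret cring "mpoly_ring n :: 'a mpoly ring" by (rule cring_mpoly_ring)
  show ?thesis
    unfolding point_ideal_def
    by (rule genideal_ideal) (auto intro: mpoly_diff_carrier mpoly_var_carrier)
qed

lemma evaluation_kernel_is_ideal:
  "ideal {f \<in> carrier (mpoly_ring n). mpoly_eval f a = 0} (mpoly_ring n)"
proof -
  interpret cring "mpoly_ring n :: 'a mpoly ring" by (rule cring_mpoly_ring)
  let ?K = "{f \<in> carrier (mpoly_ring n). mpoly_eval f a = 0}"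
  have minus: "\<ominus>\<^bsub>mpoly_ring n\<^esub> f = - f" if "f \<in> carrier (mpoly_ring n)" for f :: "'a mpoly"
    using r_neg[OF that] by (simp add: eq_neg_iff_add_eq_0 add.commute)
  have neg: "- f \<in> ?K" if "f \<in> ?K" for f
    using that mpoly_diff_carrier[of 0 n f] mpoly_eval_diff[of 0 f a] zero_closed by simp
  show ?thesis
  proof (rule idealI)
    show "subgroup ?K (add_monoid (mpoly_ring n))"
      by (rule add.subgroupI)
        (use neg zero_closed in \<open>auto simp: minus mpoly_add_carrier simp flip: a_inv_def\<close>)
  qed (auto simp: mpoly_mult_carrier ring_axioms)
qed

text \<open>
  The polynomials \<open>f\<close> for which \<open>f - f(a)\<close> lies in \<open>\<mm>\<^sub>a\<close> include the constants and the variables.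
  They are closed under products because \<open>p q - p(a) q(a) = p (q - q(a)) + (p - p(a)) q(a)\<close>.
\<close>

lemma minus_value_in_point_ideal:
  assumes "f \<in> carrier (mpoly_ring n)"
  shows "f - mpoly_const (mpoly_eval f a) \<in> point_ideal n a"
  using assms
proof (induction rule: mpoly_carrier_induct)
  case (const c)
  show ?case
    using additive_subgroup.zero_closed[OF ideal.axioms(1)[OF point_ideal_is_ideal[of n a]]]
    by simp
next
  case (var i)
  interpret cring "mpoly_ring n :: 'a mpoly ring" by (rule cring_mpoly_ring)
  have "(\<lambda>i. mpoly_var i - mpoly_const (a i)) ` {..<n} \<subseteq> point_ideal n a"
    unfolding point_ideal_def
    by (rule genideal_self) (auto intro: mpoly_diff_carrier mpoly_var_carrier)
  then show ?case
    using var by auto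
next
  case (add p q)
  have "p + q - mpoly_const (mpoly_eval (p + q) a)
      = (p - mpoly_const (mpoly_eval p a)) + (q - mpoly_const (mpoly_eval q a))"
    by (simp add: mpoly_const_def single_add)
  moreover have "\<dots> \<in> point_ideal n a"
    using additive_subgroup.a_closed[OF ideal.axioms(1)[OF point_ideal_is_ideal[of n a]]
        add.IH] by simp
  ultimately show ?case
    by metis
next
  case (mult p q)
  let ?pa = "mpoly_const (mpoly_eval p a)" and ?qa = "mpoly_const (mpoly_eval q a)"
  have "mpoly_const (mpoly_eval (p * q) a) = ?pa * ?qa"
    by (simp add: mpoly_const_def mult_single)
  then have "p * q - mpoly_const (mpoly_eval (p * q) a) = p * (q - ?qa) + (p - ?pa) * ?qa"
    by (simp add: algebra_simps)
  moreover have "p * (q - ?qa) \<in> point_ideal n a"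
    using ideal.I_l_closed[OF point_ideal_is_ideal mult.IH(2) mult.hyps(1)] by simp
  moreover have "(p - ?pa) * ?qa \<in> point_ideal n a"
    using ideal.I_r_closed[OF point_ideal_is_ideal mult.IH(1) mpoly_const_carrier] by simp
  ultimately show ?case
    using additive_subgroup.a_closed[OF ideal.axioms(1)[OF point_ideal_is_ideal[of n a]]]
    by fastforce
qed

text \<open>
  The generators of \<open>\<mm>\<^sub>a\<close> vanish at \<open>a\<close>; conversely, if \<open>f(a) = 0\<close>, then \<open>f = f - f(a)\<close>.
\<close>

lemma point_ideal_eq_kernel:
  "point_ideal n a = {f \<in> carrier (mpoly_ring n). mpoly_eval f a = 0}"
proof
  interpret cring "mpoly_ring n :: 'a mpoly ring" by (rule cring_mpoly_ring)
  show "point_ideal n a \<subseteq> {f \<in> carrier (mpoly_ring n). mpoly_eval f a = 0}"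
    unfolding point_ideal_def
    by (rule genideal_minimal[OF evaluation_kernel_is_ideal])
      (auto intro: mpoly_diff_carrier mpoly_var_carrier)
  show "{f \<in> carrier (mpoly_ring n). mpoly_eval f a = 0} \<subseteq> point_ideal n a"
  proof
    fix f
    assume f: "f \<in> {f \<in> carrier (mpoly_ring n). mpoly_eval f a = 0}"
    then show "f \<in> point_ideal n a"
      using minus_value_in_point_ideal[of f n a] by (simp add: mpoly_const_def)
  qed
qed

section \<open>The radical of the intersection\<close>

lemma comaximal_point_ideal:
  assumes I: "ideal I (mpoly_ring n)" and g: "g \<in> I" "mpoly_eval g a \<noteq> 0"
  shows "1 \<in> I <+>\<^bsub>mpoly_ring n\<^esub> point_ideal n a"
proof -
  interpret cring "mpoly_ring n :: 'a mpoly ring" by (rule cring_mpoly_ring)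
  \<comment> \<open>Rescaling \<open>g\<close> to take the value 1 at \<open>a\<close> makes \<open>1 - g1\<close> vanish there.\<close>
  define g1 where "g1 = mpoly_const (inverse (mpoly_eval g a)) * g"
  have "g1 \<in> I"
    using ideal.I_l_closed[OF I g(1) mpoly_const_carrier] by (simp add: g1_def)
  moreover have "1 - g1 \<in> point_ideal n a"
    using ideal.Icarr[OF I \<open>g1 \<in> I\<close>] one_closed g(2)
    by (simp add: point_ideal_eq_kernel mpoly_diff_carrier g1_def)
  moreover have "1 = g1 + (1 - g1)"
    by simp
  ultimately show ?thesis
    unfolding set_add_def' mpoly_ring_simps by blast
qed

theorem theorem5p2:
  fixes n :: nat
    and X :: "(nat \<Rightarrow> 'k::field) set"
    and \<nu> :: "(nat \<Rightarrow> 'k) \<Rightarrow> nat"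
    and I :: "'k mpoly set"
  assumes "X \<subseteq> affine_points n"
    and "\<nu> \<in> X \<rightarrow> {0<..}"
    and "bounded_orders X \<nu>"
    and "ideal I (mpoly_ring n)"
  shows "radical (mpoly_ring n) (Phi_star n X \<nu> I) = vanishing_ideal n (V_on n X I)"
proof
  interpret cring "mpoly_ring n :: 'k mpoly ring" by (rule cring_mpoly_ring)
  let ?M = "\<lambda>a. point_ideal n a [^]\<^bsub>ideals_set (mpoly_ring n)\<^esub> \<nu> a"
  show "radical (mpoly_ring n) (Phi_star n X \<nu> I) \<subseteq> vanishing_ideal n (V_on n X I)"
  proof
    fix f
    assume "f \<in> radical (mpoly_ring n) (Phi_star n X \<nu> I)"
    then obtain m where f: "f \<in> carrier (mpoly_ring n)" and fm: "f ^ m \<in> Phi_star n X \<nu> I"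
      by (auto simp: radical_def)
    have "mpoly_eval f a = 0" if a: "a \<in> V_on n X I" for a
    proof -
      have "a \<in> X" and I_vanishes: "\<And>g. g \<in> I \<Longrightarrow> mpoly_eval g a = 0"
        using a by (auto simp: V_on_def V_aff_def)
      then obtain g h where gh: "g \<in> I" "h \<in> ?M a" "f ^ m = g + h"
        using fm by (auto simp: Phi_star_def set_add_def')
      have "0 < \<nu> a"
        using assms(2) \<open>a \<in> X\<close> by auto
      then have "h \<in> point_ideal n a"
        using ideal_power_subset[OF point_ideal_is_ideal, of "\<nu> a" a] gh(2) by blast
      then have "mpoly_eval (f ^ m) a = 0"
        unfolding gh(3) using I_vanishes[OF gh(1)] by (simp add: point_ideal_eq_kernel)
      then show ?thesis
        by simp
    qed
    then show "f \<in> vanishing_ideal n (V_on n X I)"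
      using f by (simp add: vanishing_ideal_def)
  qed
  show "vanishing_ideal n (V_on n X I) \<subseteq> radical (mpoly_ring n) (Phi_star n X \<nu> I)"
  proof
    fix f
    assume "f \<in> vanishing_ideal n (V_on n X I)"
    then have f: "f \<in> carrier (mpoly_ring n)"
      and f_vanishes: "\<And>a. a \<in> V_on n X I \<Longrightarrow> mpoly_eval f a = 0"
      by (auto simp: vanishing_ideal_def)
    obtain N where N: "N > 0" "\<And>a. a \<in> X \<Longrightarrow> \<nu> a \<le> N"
      using assms(3) by (auto simp: bounded_orders_def)
    have fN: "f ^ N \<in> carrier (mpoly_ring n)"
      using nat_pow_closed[OF f, of N] by simp
    have "f ^ N \<in> I <+>\<^bsub>mpoly_ring n\<^esub> ?M a" if a: "a \<in> X" for a
    proof (cases "a \<in> V_aff n I")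
      case True
      then have "f \<in> point_ideal n a"
        using f f_vanishes a by (simp add: point_ideal_eq_kernel V_on_def)
      then have "f ^ N \<in> ?M a"
        using pow_mem_ideal_power[OF point_ideal_is_ideal _ N(2)[OF a]] by simp
      moreover have "0 \<in> I"
        using additive_subgroup.zero_closed[OF ideal.axioms(1)[OF assms(4)]] by simp
      ultimately show ?thesis
        unfolding set_add_def' by fastforce
    next
      case False
      then obtain g where "g \<in> I" "mpoly_eval g a \<noteq> 0"
        using a assms(1) by (auto simp: V_aff_def)
      then have "\<one>\<^bsub>mpoly_ring n\<^esub> \<in> I <+>\<^bsub>mpoly_ring n\<^esub> point_ideal n a"
        using comaximal_point_ideal[OF assms(4)] by simp
      then show ?thesis
        using comaximal_ideal_power[OF assms(4) point_ideal_is_ideal] fN by simp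
    qed
    then have "f ^ N \<in> Phi_star n X \<nu> I"
      using fN by (simp add: Phi_star_def)
    then show "f \<in> radical (mpoly_ring n) (Phi_star n X \<nu> I)"
      using f N(1) by (auto simp: radical_def)
  qed
qed

end
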